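(* There is a $\Pi^0_1$ (i.e., effectively closed) set $\mathcal E \subseteq {}^{\mathbb N}\mathbb N$ which is a maximal eventually different family.
   Context: ${}^{\mathbb N}\mathbb N$ is the set of functions from $\mathbb N$ to $\mathbb N$ (Baire space). Two functions $f_0,f_1 \in {}^{\mathbb N}\mathbb N$ are eventually different if $\{n \in \mathbb N : f_0(n)=f_1(n)\}$ is finite. A set $\mathcal E \subseteq {}^{\mathbb N}\mathbb N$ is an eventually different family if any two distinct elements of $\mathcal E$ are eventually different; it is maximal if it is maximal with respect to inclusion among eventually different families. $\Pi^0_1$ is the lightface class: a subset of ${}^{\mathbb N}\mathbb N$ is $\Pi^0_1$ (effectively closed) if its complement is the union of a computably enumerable family of basic open sets $\{f : s\subseteq f\}$, with $s$ a finite sequence of natural numbers. The base theory is ZF (no choice is assumed). *)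

theory Defs
  imports "HOL-Library.Nat_Bijection"
begin

section \<open>Partial recursive functions\<close>

text \<open>
  Kleene's schemes for partial recursive functions. Codes carry no arity: the arity is the
  length of the argument list, and a code of the wrong shape has no value there.
\<close>

datatype recf =
    Zero
  | Succ
  | Proj nat
  | Comp recf "recf list"
  | PrimRec recf recf
  | Mu recf

text \<open>\<open>computes c xs y\<close>: the function coded by \<open>c\<close> is defined at \<open>xs\<close>, with value \<open>y\<close>.
  In the schemes for \<open>PrimRec\<close> and \<open>Mu\<close> the recursion or search variable comes first;
  as usual, \<open>Mu\<close> requires the values below the least zero to be defined and nonzero.\<close>

inductive computes :: "recf \<Rightarrow> nat list \<Rightarrow> nat \<Rightarrow> bool" where
  zero: "computes Zero xs 0"
| succ: "computes Succ [x] (Suc x)"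
| proj: "i < length xs \<Longrightarrow> computes (Proj i) xs (xs ! i)"
| comp: "list_all2 (\<lambda>g y. computes g xs y) gs ys \<Longrightarrow> computes f ys z
    \<Longrightarrow> computes (Comp f gs) xs z"
| primrec_0: "computes f xs z \<Longrightarrow> computes (PrimRec f g) (0 # xs) z"
| primrec_Suc: "computes (PrimRec f g) (n # xs) y \<Longrightarrow> computes g (n # y # xs) z
    \<Longrightarrow> computes (PrimRec f g) (Suc n # xs) z"
| mu: "computes f (n # xs) 0 \<Longrightarrow> (\<forall>m<n. \<exists>y. computes f (m # xs) (Suc y))
    \<Longrightarrow> computes (Mu f) xs n"
monos list_all2_mono

inductive_cases computes_elims:
  "computes Zero xs z"
  "computes Succ xs z"
  "computes (Proj i) xs z"
  "computes (Comp f gs) xs z"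
  "computes (PrimRec f g) (0 # xs) z"
  "computes (PrimRec f g) (Suc n # xs) z"
  "computes (Mu f) xs z"

lemma computes_deterministic:
  "computes c xs y \<Longrightarrow> computes c xs z \<Longrightarrow> y = z"
proof (induction c xs y arbitrary: z rule: computes.induct)
  case (zero xs)
  then show ?case by (rule computes_elims(1)) simp
next
  case (succ x)
  then show ?case by (rule computes_elims(2)) simp
next
  case (proj i xs)
  from proj.prems show ?case by (rule computes_elims(3)) simp
next
  case (comp xs gs ys f z z')
  from comp.prems obtain ys' where ys': "list_all2 (\<lambda>g y. computes g xs y) gs ys'"
    and z': "computes f ys' z'"
    by (rule computes_elims(4))
  have "ys = ys'"
    using comp.IH(1) ys' by (auto simp: list_all2_conv_all_nth intro!: nth_equalityI)
  with comp.IH(2) z' show ?case by blast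
next
  case (primrec_0 f xs z g z')
  from primrec_0.prems have "computes f xs z'" by (rule computes_elims(5))
  with primrec_0.IH show ?case by blast
next
  case (primrec_Suc f g n xs y z z')
  from primrec_Suc.prems obtain y' where "computes (PrimRec f g) (n # xs) y'"
    and "computes g (n # y' # xs) z'"
    by (rule computes_elims(6))
  with primrec_Suc.IH show ?case by blast
next
  case (mu f n xs z)
  from mu.prems have z: "computes f (z # xs) 0"
    and below: "\<forall>m<z. \<exists>y. computes f (m # xs) (Suc y)"
    by (blast elim: computes_elims(7))+
  have "\<not> z < n" using mu.IH(2) z by blast
  moreover have "\<not> n < z" using mu.IH(1) below by blast
  ultimately show ?case by simp
qed

definition comp_enumerable :: "nat set \<Rightarrow> bool" where
  "comp_enumerable A \<longleftrightarrow> (\<exists>c. A = {n. \<exists>y. computes c [n] y})"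


section \<open>Effectively closed subsets of Baire space\<close>

definition basic_open :: "nat list \<Rightarrow> (nat \<Rightarrow> nat) set" where
  "basic_open s = {f. \<forall>i < length s. f i = s ! i}"

definition effectively_closed :: "(nat \<Rightarrow> nat) set \<Rightarrow> bool" where
  "effectively_closed X \<longleftrightarrow>
    (\<exists>S. comp_enumerable (list_encode ` S) \<and> - X = (\<Union>s\<in>S. basic_open s))"


section \<open>Maximal eventually different families\<close>

definition eventually_different :: "(nat \<Rightarrow> nat) \<Rightarrow> (nat \<Rightarrow> nat) \<Rightarrow> bool" where
  "eventually_different f g \<longleftrightarrow> finite {n. f n = g n}"

definition ev_diff_family :: "(nat \<Rightarrow> nat) set \<Rightarrow> bool" where
  "ev_diff_family E \<longleftrightarrow> pairwise eventually_different E"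

definition maximal_ev_diff_family :: "(nat \<Rightarrow> nat) set \<Rightarrow> bool" where
  "maximal_ev_diff_family E \<longleftrightarrow>
    ev_diff_family E \<and> (\<forall>F. ev_diff_family F \<longrightarrow> E \<subseteq> F \<longrightarrow> F = E)"

end

theory Submission imports Defs begin

text \<open>Write \<open>history f n\<close> for the code of the sequence \<open>f 0, \<dots>, f (n - 1)\<close>. The functions
  \<open>history f\<close> are pairwise eventually different, since \<open>history f n\<close> determines \<open>f\<close> below \<open>n\<close>,
  but they are far from maximal. The cure is to let \<open>f\<close> carry an arbitrary function \<open>h\<close> and to
  replace \<open>history f\<close> by \<open>h\<close> on a sparse set of positions which, for a suitable \<open>f\<close>, is
  infinite, so that the changed function meets \<open>h\<close> infinitely often.

  The sparse sets must not destroy eventual difference. Let \<open>f\<close> carry \<open>h = f \<circ> Suc\<close> and a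
  parameter \<open>p = f 0\<close>. Changes are only made inside \<open>prefix_positions h\<close>, the set of the numbers
  \<open>2 x + 1\<close> for which \<open>x\<close> encodes an initial segment of \<open>h\<close>; for different \<open>h\<close> these sets are
  almost disjoint. On this set, put
  \<open>m\<close> below \<open>n\<close> if \<open>h m\<close> and \<open>h n\<close> look like two values of one history. This is a forest,
  because the values that \<open>h n\<close> prescribes at smaller positions are unique. The change is made on
  the set of children of the node \<open>p - 1\<close> (on the roots, if \<open>p = 0\<close>). Sets of children of
  different nodes are disjoint, and such a set is an antichain, so \<open>h\<close> agrees with any given
  \<open>history g\<close> on at most one point of it. Hence all the resulting functions are pairwise eventually
  different (\<open>twisted_history_eventually_different\<close>).

  The family is maximal. Given \<open>h\<close>, if some node of the forest has infinitely many children, it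
  yields a \<open>p\<close> for which the member that carries \<open>(p, h)\<close> meets \<open>h\<close> infinitely often. Otherwise
  Koenig's lemma gives an infinite path (\<open>infinite_path\<close>), that is, a \<open>g\<close> whose history agrees with
  \<open>h\<close> infinitely often, and the member of \<open>g\<close> inherits infinitely many of these agreements
  (\<open>twisted_history_meets_every_function\<close>).

  The family is effectively closed. The value of a member at \<open>n\<close> depends only on the values of
  \<open>f\<close> up to \<open>n + 1\<close>, in a computable way. All \<open>f\<close> are admitted, also those with finitely many
  changes: that the set of changes is infinite could not be seen from finite initial segments.
  Changes happen at odd positions only, so the
  even values of a member list longer and longer initial segments of \<open>f\<close>, and a function belongs to
  the family iff each of its values is the one that is computed from the segments listed at later
  even positions (\<open>range_twisted_history_iff\<close>). A violation is visible in a finite initial segment.\<close>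

section \<open>Computable functions of an environment\<close>

text \<open>Functions of several arguments are represented as functions of an infinite environment, whose
  \<open>i\<close>-th entry is the value of the variable \<open>i\<close>. Binding a variable shifts the environment by one,
  so the closure rules below apply by resolution to the body of a definition, without any
  bookkeeping of arities. Codes exist for all large arities, so that the variables of several
  functions can be padded to a common arity.\<close>

definition computable :: "((nat \<Rightarrow> nat) \<Rightarrow> nat) \<Rightarrow> bool" where
  "computable F \<longleftrightarrow> (\<exists>k. \<forall>n\<ge>k. \<exists>c. \<forall>e. computes c (map e [0..<n]) (F e))"

definition decidable :: "((nat \<Rightarrow> nat) \<Rightarrow> bool) \<Rightarrow> bool" where
  "decidable P \<longleftrightarrow> computable (\<lambda>e. of_bool (P e))"

lemma computable_var: "computable (\<lambda>e. e i)"
proof -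
  have "computes (Proj i) (map e [0..<n]) (e i)" if "Suc i \<le> n" for n and e :: "nat \<Rightarrow> nat"
    using proj[of i "map e [0..<n]"] that by simp
  then show ?thesis unfolding computable_def by blast
qed

lemma computable_0: "computable (\<lambda>e. 0)"
  unfolding computable_def using zero by blast

lemma computable_Suc:
  assumes "computable F"
  shows "computable (\<lambda>e. Suc (F e))"
proof -
  obtain k where k: "\<forall>n\<ge>k. \<exists>c. \<forall>e. computes c (map e [0..<n]) (F e)"
    using assms unfolding computable_def by blast
  have "\<exists>c. \<forall>e. computes c (map e [0..<n]) (Suc (F e))" if n: "n \<ge> k" for n
  proof -
    obtain c where "\<forall>e. computes c (map e [0..<n]) (F e)" using k n by blast
    then have "\<forall>e. computes (Comp Succ [c]) (map e [0..<n]) (Suc (F e))"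
      by (auto intro!: computes.comp[where ys = "[F _]"] succ)
    then show ?thesis by blast
  qed
  then show ?thesis unfolding computable_def by blast
qed

lemma computable_substitute:
  assumes F: "computable F" and G: "\<And>j. computable (G j)"
  shows "computable (\<lambda>e. F (\<lambda>j. G j e))"
proof -
  obtain k c where c: "\<And>e. computes c (map e [0..<k]) (F e)"
    using F unfolding computable_def by blast
  obtain r where r: "\<And>j n. n \<ge> r j \<Longrightarrow> \<exists>d. \<forall>e. computes d (map e [0..<n]) (G j e)"
    using G unfolding computable_def by metis
  (* F only reads the first k variables; the sum is an arity that suffices for all k arguments *)
  have "\<exists>d. \<forall>e. computes d (map e [0..<n]) (F (\<lambda>j. G j e))" if n: "n \<ge> (\<Sum>j<k. r j)" for n
  proof -
    have "r j \<le> n" if "j < k" for j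
      using member_le_sum[of j "{..<k}" r] that n by simp
    then have "\<forall>j\<in>{..<k}. \<exists>d. \<forall>e. computes d (map e [0..<n]) (G j e)" using r by simp
    from bchoice[OF this] obtain d
      where d: "\<And>j e. j < k \<Longrightarrow> computes (d j) (map e [0..<n]) (G j e)" by auto
    have "computes (Comp c (map d [0..<k])) (map e [0..<n]) (F (\<lambda>j. G j e))" for e
      using c[of "\<lambda>j. G j e"]
      by (intro computes.comp[where ys = "map (\<lambda>j. G j e) [0..<k]"])
        (auto simp: list_all2_conv_all_nth d)
    then show ?thesis by blast
  qed
  then show ?thesis unfolding computable_def by blast
qed

lemma computable_compose:
  assumes "computable (\<lambda>e. f (e 0))" "computable F"
  shows "computable (\<lambda>e. f (F e))"
  using computable_substitute[OF assms(1), of "\<lambda>_. F"] assms(2) by blast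

lemma computable_compose2:
  assumes "computable (\<lambda>e. f (e 0) (e 1))" "computable F" "computable G"
  shows "computable (\<lambda>e. f (F e) (G e))"
proof -
  let ?H = "\<lambda>j :: nat. if j = 0 then F else G"
  have "computable (?H j)" for j using assms(2,3) by simp
  from computable_substitute[OF assms(1), of ?H, OF this] show ?thesis by simp
qed

lemma map_environment_Cons: "x # map e [0..<n] = map (case_nat x e) [0..<Suc n]"
  by (simp add: upt_conv_Cons map_Suc_upt[symmetric] del: upt_Suc)

lemma computes_projections:
  "list_all2 (\<lambda>g y. computes g (map e [0..<n]) y) (map Proj [0..<n]) (map e [0..<n])"
  using proj[of _ "map e [0..<n]"] by (auto simp: list_all2_conv_all_nth)

lemma computable_rec:
  assumes "computable N" "computable Z" "computable (\<lambda>e. S (e 0) (e (Suc 0)) (\<lambda>j. e (Suc (Suc j))))"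
  shows "computable (\<lambda>e. rec_nat (Z e) (\<lambda>i y. S i y e) (N e))"
proof -
  obtain k1 k2 k3 where
    k1: "\<forall>n\<ge>k1. \<exists>c. \<forall>e. computes c (map e [0..<n]) (N e)" and
    k2: "\<forall>n\<ge>k2. \<exists>c. \<forall>e. computes c (map e [0..<n]) (Z e)" and
    k3: "\<forall>n\<ge>k3. \<exists>c. \<forall>e. computes c (map e [0..<n]) (S (e 0) (e (Suc 0)) (\<lambda>j. e (Suc (Suc j))))"
    using assms unfolding computable_def by blast
  have "\<exists>c. \<forall>e. computes c (map e [0..<n]) (rec_nat (Z e) (\<lambda>i y. S i y e) (N e))"
    if n: "n \<ge> max k1 (max k2 k3)" for n
  proof -
    obtain c1 where c1: "\<And>e. computes c1 (map e [0..<n]) (N e)" using k1 n by fastforce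
    obtain c2 where c2: "\<And>e. computes c2 (map e [0..<n]) (Z e)" using k2 n by fastforce
    have "Suc (Suc n) \<ge> k3" using n by simp
    then obtain c3 where c3: "\<And>e. computes c3 (map e [0..<Suc (Suc n)])
        (S (e 0) (e (Suc 0)) (\<lambda>j. e (Suc (Suc j))))" using k3 by blast
    have step: "computes c3 (i # y # map e [0..<n]) (S i y e)" for i y e
      using c3[of "case_nat i (case_nat y e)"] by (simp add: map_environment_Cons del: upt_Suc)
    have "computes (PrimRec c2 c3) (m # map e [0..<n]) (rec_nat (Z e) (\<lambda>i y. S i y e) m)" for m e
      by (induction m) (auto intro: primrec_0 primrec_Suc c2 step)
    then have "\<forall>e. computes (Comp (PrimRec c2 c3) (c1 # map Proj [0..<n])) (map e [0..<n])
        (rec_nat (Z e) (\<lambda>i y. S i y e) (N e))"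
      by (intro allI computes.comp[where ys = "N _ # map _ [0..<n]"])
        (auto intro: c1 computes_projections)
    then show ?thesis by blast
  qed
  then show ?thesis unfolding computable_def by blast
qed

lemma computable_add: "computable F \<Longrightarrow> computable G \<Longrightarrow> computable (\<lambda>e. F e + G e)"
proof -
  have "a + b = rec_nat a (\<lambda>_ y. Suc y) b" for a b :: nat by (induction b) auto
  then show "computable F \<Longrightarrow> computable G \<Longrightarrow> computable (\<lambda>e. F e + G e)"
    by (auto intro!: computable_rec computable_Suc computable_var)
qed

lemma computable_pred: "computable F \<Longrightarrow> computable (\<lambda>e. F e - Suc 0)"
proof -
  have "a - Suc 0 = rec_nat 0 (\<lambda>i _. i) a" for a by (cases a) auto
  then show "computable F \<Longrightarrow> computable (\<lambda>e. F e - Suc 0)"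
    by (auto intro!: computable_rec computable_0 computable_var)
qed

lemma computable_diff:
  assumes "computable F" "computable G"
  shows "computable (\<lambda>e. F e - G e)"
proof -
  have "a - b = rec_nat a (\<lambda>_ y. y - Suc 0) b" for a b :: nat by (induction b) auto
  then have "(\<lambda>e. F e - G e) = (\<lambda>e. rec_nat (F e) (\<lambda>_ y. y - Suc 0) (G e))" by (rule ext)
  then show ?thesis using assms by (simp only:) (intro computable_rec computable_pred computable_var)
qed

lemma computable_triangle: "computable F \<Longrightarrow> computable (\<lambda>e. triangle (F e))"
proof -
  have "triangle a = rec_nat 0 (\<lambda>i y. y + Suc i) a" for a by (induction a) auto
  then show "computable F \<Longrightarrow> computable (\<lambda>e. triangle (F e))"
    by (auto intro!: computable_rec computable_add computable_0 computable_Suc computable_var)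
qed

text \<open>Truth values are the numbers \<open>0\<close> and \<open>1\<close>, and the connectives are expressed by sums and truncated
  differences.\<close>

lemma decidable_not: "decidable P \<Longrightarrow> decidable (\<lambda>e. \<not> P e)"
proof -
  have eq: "of_bool (\<not> p) = Suc 0 - of_bool p" for p by (cases p) auto
  show "decidable P \<Longrightarrow> decidable (\<lambda>e. \<not> P e)"
    unfolding decidable_def eq by (intro computable_diff computable_Suc computable_0)
qed

lemma decidable_disj: "decidable P \<Longrightarrow> decidable Q \<Longrightarrow> decidable (\<lambda>e. P e \<or> Q e)"
proof -
  have eq: "of_bool (p \<or> q) = Suc 0 - (Suc 0 - (of_bool p + of_bool q))" for p q by auto
  show "decidable P \<Longrightarrow> decidable Q \<Longrightarrow> decidable (\<lambda>e. P e \<or> Q e)"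
    unfolding decidable_def eq by (intro computable_diff computable_add computable_Suc computable_0)
qed

lemma decidable_conj: "decidable P \<Longrightarrow> decidable Q \<Longrightarrow> decidable (\<lambda>e. P e \<and> Q e)"
  using decidable_not[OF decidable_disj[OF decidable_not decidable_not]] by simp

lemma decidable_imp: "decidable P \<Longrightarrow> decidable Q \<Longrightarrow> decidable (\<lambda>e. P e \<longrightarrow> Q e)"
  unfolding imp_conv_disj by (intro decidable_disj decidable_not)

lemma decidable_le: "computable F \<Longrightarrow> computable G \<Longrightarrow> decidable (\<lambda>e. F e \<le> G e)"
proof -
  have eq: "of_bool (a \<le> b) = Suc 0 - (a - b)" for a b :: nat by auto
  show "computable F \<Longrightarrow> computable G \<Longrightarrow> decidable (\<lambda>e. F e \<le> G e)"
    unfolding decidable_def eq by (intro computable_diff computable_Suc computable_0)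
qed

lemma decidable_less: "computable F \<Longrightarrow> computable G \<Longrightarrow> decidable (\<lambda>e. F e < G e)"
  unfolding not_le[symmetric] by (intro decidable_not decidable_le)

lemma decidable_eq: "computable F \<Longrightarrow> computable G \<Longrightarrow> decidable (\<lambda>e. F e = G e)"
proof -
  have eq: "a = b \<longleftrightarrow> a \<le> b \<and> b \<le> a" for a b :: nat by auto
  show "computable F \<Longrightarrow> computable G \<Longrightarrow> decidable (\<lambda>e. F e = G e)"
    unfolding eq by (intro decidable_conj decidable_le)
qed

lemma decidable_Ex_less:
  assumes "computable B" "decidable (\<lambda>e. P (e 0) (\<lambda>j. e (Suc j)))"
  shows "decidable (\<lambda>e. \<exists>i<B e. P i e)"
proof -
  have eq: "of_bool (\<exists>i<b. Q i) = rec_nat 0 (\<lambda>i y. Suc 0 - (Suc 0 - (y + of_bool (Q i)))) b"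
    for b :: nat and Q
  proof (induction b)
    case (Suc b)
    have "(\<exists>i<Suc b. Q i) \<longleftrightarrow> (\<exists>i<b. Q i) \<or> Q b" by (auto simp: less_Suc_eq)
    then show ?case
      by (cases "Q b"; cases "\<exists>i<b. Q i") (simp_all add: Suc.IH[symmetric])
  qed simp
  (* the recursion binds two variables where the quantifier binds one *)
  have "computable (\<lambda>e. of_bool (P (e 0) (\<lambda>j. e (Suc (Suc j)))))"
  proof -
    let ?r = "case_nat 0 (\<lambda>i. Suc (Suc i))"
    show ?thesis
      using computable_substitute[OF assms(2)[unfolded decidable_def], of "\<lambda>j e. e (?r j)",
          OF computable_var] by simp
  qed
  then show ?thesis unfolding decidable_def eq
    using assms(1)
    by (intro computable_rec computable_diff computable_add computable_Suc computable_0 computable_var)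
qed

lemma decidable_All_less:
  assumes "computable B" "decidable (\<lambda>e. P (e 0) (\<lambda>j. e (Suc j)))"
  shows "decidable (\<lambda>e. \<forall>i<B e. P i e)"
  using decidable_not[OF decidable_Ex_less[OF assms(1) decidable_not[OF assms(2)]]] by simp

text \<open>Unbounded search is the scheme \<open>Mu\<close> applied to the characteristic function of the negation,
  which vanishes exactly at the solutions.\<close>

lemma computable_Least:
  assumes P: "decidable (\<lambda>e. P (e 0) (\<lambda>j. e (Suc j)))" and ex: "\<And>e. \<exists>i. P i e"
  shows "computable (\<lambda>e. LEAST i. P i e)"
proof -
  have "computable (\<lambda>e. of_bool (\<not> P (e 0) (\<lambda>j. e (Suc j))))"
    using decidable_not[OF P] unfolding decidable_def .
  then obtain k where k: "\<forall>n\<ge>k. \<exists>c. \<forall>e. computes c (map e [0..<n])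
      (of_bool (\<not> P (e 0) (\<lambda>j. e (Suc j))))"
    unfolding computable_def by blast
  have "\<exists>c. \<forall>e. computes c (map e [0..<n]) (LEAST i. P i e)" if n: "n \<ge> k" for n
  proof -
    have "Suc n \<ge> k" using n by simp
    then obtain c where c: "\<And>e. computes c (map e [0..<Suc n])
        (of_bool (\<not> P (e 0) (\<lambda>j. e (Suc j))))" using k by blast
    have search: "computes c (i # map e [0..<n]) (of_bool (\<not> P i e))" for i e
      using c[of "case_nat i e"] by (simp add: map_environment_Cons del: upt_Suc)
    have "computes (Mu c) (map e [0..<n]) (LEAST i. P i e)" for e
    proof (rule computes.mu)
      show "computes c ((LEAST i. P i e) # map e [0..<n]) 0"
        using search[of "LEAST i. P i e" e] LeastI_ex[OF ex] by simp
      show "\<forall>m<(LEAST i. P i e). \<exists>y. computes c (m # map e [0..<n]) (Suc y)"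
      proof (intro allI impI)
        fix m assume "m < (LEAST i. P i e)"
        then have "\<not> P m e" by (rule not_less_Least)
        then have "computes c (m # map e [0..<n]) (Suc 0)" using search[of m e] by simp
        then show "\<exists>y. computes c (m # map e [0..<n]) (Suc y)" ..
      qed
    qed
    then show ?thesis by blast
  qed
  then show ?thesis unfolding computable_def by blast
qed

text \<open>The search for a zero of a function that ignores the search variable halts iff its value is zero.\<close>

lemma comp_enumerable_decidable:
  assumes "decidable (\<lambda>e. P (e 0))"
  shows "comp_enumerable {x. P x}"
proof -
  obtain k c where c: "\<And>e. computes c (map e [0..<k]) (of_bool (\<not> P (e 0)))"
    using decidable_not[OF assms] unfolding decidable_def computable_def by blast
  define d where "d = Comp c (map (\<lambda>i. if i = 0 then Proj 1 else Zero) [0..<k])"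
  have d: "computes d [m, x] (of_bool (\<not> P x))" for m x
  proof -
    let ?e = "\<lambda>i::nat. if i = 0 then x else 0"
    have "computes (Proj 1) [m, x] x" using proj[of 1 "[m, x]"] by simp
    then show ?thesis
      unfolding d_def using c[of ?e]
      by (intro computes.comp[where ys = "map ?e [0..<k]"])
        (auto simp: list_all2_conv_all_nth intro: zero)
  qed
  have "P x \<longleftrightarrow> (\<exists>y. computes (Mu d) [x] y)" for x
  proof
    assume "P x"
    then have "computes (Mu d) [x] 0" using d[of 0 x] by (intro computes.mu) auto
    then show "\<exists>y. computes (Mu d) [x] y" ..
  next
    assume "\<exists>y. computes (Mu d) [x] y"
    then obtain y where "computes d [y, x] 0" by (blast elim: computes_elims(7))
    from computes_deterministic[OF this d] show "P x" by auto
  qed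
  then show ?thesis unfolding comp_enumerable_def by blast
qed

lemmas computability_intros =
  computable_var computable_0 computable_Suc computable_add decidable_not decidable_disj
  decidable_conj decidable_imp decidable_le decidable_less decidable_eq
  decidable_Ex_less decidable_All_less

section \<open>Entries of coded sequences\<close>

abbreviation len :: "nat \<Rightarrow> nat" where
  "len x \<equiv> length (list_decode x)"

definition entry :: "nat \<Rightarrow> nat \<Rightarrow> nat" where
  "entry x i = (if i < len x then list_decode x ! i else 0)"

text \<open>The components of \<open>prod_decode\<close> are found by search. Iterating the second component runs
  through the codes of the tails of a sequence; an entry is the head of a tail, and the length is
  the number of steps to the code \<open>0\<close> of the empty sequence.\<close>

lemma computable_entry: "computable (\<lambda>e. entry (e 0) (e 1))"
  and computable_len: "computable (\<lambda>e. len (e 0))"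
proof -
  define first where "first z = (LEAST a. \<exists>b<Suc z. z = triangle (a + b) + a)" for z
  define second where "second z = (LEAST b. \<exists>a<Suc z. z = triangle (a + b) + a)" for z
  have le: "n \<le> triangle n" for n by (induction n) auto
  have bound: "a < Suc (triangle (a + b) + a)" "b < Suc (triangle (a + b) + a)" for a b
    using le[of "a + b"] by linarith+
  have unique: "triangle (a + b) + a = triangle (c + d) + c \<longleftrightarrow> a = c \<and> b = d" for a b c d
    using prod_encode_eq[of "(a, b)" "(c, d)"] by (simp add: prod_encode_def)
  have proj: "first (prod_encode (a, b)) = a" "second (prod_encode (a, b)) = b" for a b
    unfolding first_def second_def prod_encode_def
    by (rule Least_equality; use bound in \<open>auto simp: unique\<close>)+
  have ex: "\<exists>a. \<exists>b<Suc z. z = triangle (a + b) + a" "\<exists>b. \<exists>a<Suc z. z = triangle (a + b) + a" for z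
  proof -
    obtain a b where "z = triangle (a + b) + a"
      using prod_decode_inverse[of z] by (cases "prod_decode z") (auto simp: prod_encode_def)
    with bound(1)[of a b] bound(2)[of b a] have "a < Suc z \<and> b < Suc z \<and> z = triangle (a + b) + a" by simp
    then show "\<exists>a. \<exists>b<Suc z. z = triangle (a + b) + a"
      "\<exists>b. \<exists>a<Suc z. z = triangle (a + b) + a" by blast+
  qed
  have "computable (\<lambda>e. first (e 0))" "computable (\<lambda>e. second (e 0))"
    unfolding first_def second_def
    by (intro computable_Least computability_intros computable_triangle ex)+
  note first = computable_compose[of first, OF this(1)]
    and second = computable_compose[of second, OF this(2)]
  define rest where "rest x = rec_nat x (\<lambda>_ y. second (y - Suc 0))" for x
  have zero: "first 0 = 0" "second 0 = 0"
    using proj[of 0 0] by (simp_all add: prod_encode_def)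
  have rest: "rest x i = list_encode (drop i (list_decode x))" for x i
  proof (induction i)
    case (Suc i)
    show ?case
    proof (cases "drop i (list_decode x)")
      case Nil
      then show ?thesis using Suc by (simp add: rest_def zero drop_Suc)
    next
      case (Cons a as)
      then have "drop (Suc i) (list_decode x) = as" by (metis drop_Suc list.sel(3) tl_drop)
      with Cons Suc show ?thesis by (simp add: rest_def proj)
    qed
  qed (simp add: rest_def)
  have crest: "computable (\<lambda>e. rest (e i) (e j))" for i j
    unfolding rest_def by (intro computable_rec computability_intros second computable_pred)
  have "entry x i = first (rest x i - Suc 0)" for x i
  proof (cases "i < len x")
    case True
    then show ?thesis by (simp add: rest entry_def proj Cons_nth_drop_Suc[symmetric])
  qed (simp add: rest entry_def zero)
  then show "computable (\<lambda>e. entry (e 0) (e 1))"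
    by (auto intro!: first computable_pred crest)
  have empty: "rest x i = 0 \<longleftrightarrow> len x \<le> i" for x i
    using list_encode_eq[of "drop i (list_decode x)" "[]"] by (simp add: rest)
  have eq: "len x = (LEAST i. rest x i = 0)" for x
    unfolding empty by (rule Least_equality[symmetric]) auto
  have halts: "\<exists>i. rest x i = 0" for x using empty by blast
  show "computable (\<lambda>e. len (e 0))"
    unfolding eq by (intro computable_Least computability_intros crest halts)
qed

lemmas computable_entries =
  computable_compose[of len, OF computable_len] computable_compose2[of entry, OF computable_entry]

lemma entry_list_encode: "i < length xs \<Longrightarrow> entry (list_encode xs) i = xs ! i"
  by (simp add: entry_def)

section \<open>The family\<close>

definition history :: "(nat \<Rightarrow> nat) \<Rightarrow> nat \<Rightarrow> nat" where
  "history f n = list_encode (map f [0..<n])"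

text \<open>In this form the equation is decidable by bounded quantification over entries, without computing
  the code of a sequence.\<close>

lemma history_eq_iff:
  "x = history f n \<longleftrightarrow> len x = n \<and> (\<forall>i<n. entry x i = f i)"
proof
  assume "len x = n \<and> (\<forall>i<n. entry x i = f i)"
  then have "list_decode x = map f [0..<n]"
    by (intro nth_equalityI) (auto simp: entry_def)
  then show "x = history f n" unfolding history_def by (metis list_decode_inverse)
qed (simp add: history_def entry_def)

lemma len_history [simp]: "len (history f n) = n"
  and entry_history [simp]: "i < n \<Longrightarrow> entry (history f n) i = f i"
  using history_eq_iff[of "history f n" f n] by auto

text \<open>Positions are odd, which keeps every even value of a member of the family unchanged.\<close>

definition prefix_positions :: "(nat \<Rightarrow> nat) \<Rightarrow> nat set" where
  "prefix_positions h = {n. \<exists>x<n. n = Suc (x + x) \<and> (\<forall>i<len x. entry x i = h i)}"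

lemma Suc_double_in_prefix_positions_iff: "Suc (x + x) \<in> prefix_positions h \<longleftrightarrow> (\<forall>i<len x. entry x i = h i)"
proof -
  have "x + x = y + y \<longleftrightarrow> x = y" for y by arith
  then show ?thesis by (simp add: prefix_positions_def)
qed

lemma odd_prefix_positions: "n \<in> prefix_positions h \<Longrightarrow> odd n"
  by (auto simp: prefix_positions_def)

lemma infinite_prefix_positions: "infinite (prefix_positions h)"
proof -
  have "inj (\<lambda>k. Suc (history h k + history h k))"
    by (rule injI) (metis add_self_div_2 len_history nat.inject)
  moreover have "range (\<lambda>k. Suc (history h k + history h k)) \<subseteq> prefix_positions h"
    by (auto simp: Suc_double_in_prefix_positions_iff)
  ultimately show ?thesis by (meson finite_imageD finite_subset infinite_UNIV_nat)
qed

lemma finite_prefix_positions_Int: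
  assumes "h \<noteq> h'"
  shows "finite (prefix_positions h \<inter> prefix_positions h')"
proof -
  obtain d where d: "h d \<noteq> h' d" using assms by blast
  have "prefix_positions h \<inter> prefix_positions h' \<subseteq> (\<lambda>x. Suc (x + x)) ` (\<Union>n\<le>d. {history h n})"
  proof
    fix n assume n: "n \<in> prefix_positions h \<inter> prefix_positions h'"
    then obtain x where x: "n = Suc (x + x)" "\<forall>i<len x. entry x i = h i"
      by (auto simp: prefix_positions_def)
    with n have "\<forall>i<len x. entry x i = h' i" by (simp add: Suc_double_in_prefix_positions_iff)
    with x d have "len x \<le> d" by (metis not_le)
    moreover have "x = history h (len x)" using x history_eq_iff by simp
    ultimately show "n \<in> (\<lambda>x. Suc (x + x)) ` (\<Union>n\<le>d. {history h n})" using x(1) by blast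
  qed
  then show ?thesis by (rule finite_subset) simp
qed

text \<open>The pairs \<open>h m\<close>, \<open>h n\<close> that are values of one history satisfy this. The relation is transitive and
  the predecessors of each \<open>n\<close> are linearly ordered, so it is a forest on the natural numbers. Fixing
  the length of \<open>h m\<close> makes the sequences grow along an infinite path; that of \<open>h n\<close> is only
  bounded from below, so that leaves may carry arbitrary values.\<close>

definition below :: "(nat \<Rightarrow> nat) \<Rightarrow> nat \<Rightarrow> nat \<Rightarrow> bool" where
  "below h m n \<longleftrightarrow> m < n \<and> len (h m) = m \<and> m \<le> len (h n) \<and>
    (\<forall>i<m. entry (h m) i = entry (h n) i)"

lemma below_trans: "below h l m \<Longrightarrow> below h m n \<Longrightarrow> below h l n"
  by (auto simp: below_def)

lemma below_linear: "below h l n \<Longrightarrow> below h m n \<Longrightarrow> l < m \<Longrightarrow> below h l m"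
  by (auto simp: below_def)

lemma below_if_history:
  "h m = history g m \<Longrightarrow> h n = history g n \<Longrightarrow> m < n \<Longrightarrow> below h m n"
  by (auto simp: below_def)

text \<open>The number is \<open>Suc m\<close> for the largest \<open>m\<close> of \<open>prefix_positions h\<close> below \<open>n\<close>, and \<open>0\<close> if
  there is none, that is, if \<open>n\<close> is a root.\<close>

definition parent :: "(nat \<Rightarrow> nat) \<Rightarrow> nat \<Rightarrow> nat" where
  "parent h n = (LEAST p. \<forall>m<n. m \<in> prefix_positions h \<longrightarrow> below h m n \<longrightarrow> m < p)"

lemma less_parent: "m \<in> prefix_positions h \<Longrightarrow> below h m n \<Longrightarrow> m < parent h n"
proof -
  have "\<forall>m<n. m \<in> prefix_positions h \<longrightarrow> below h m n \<longrightarrow> m < parent h n"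
    unfolding parent_def by (rule LeastI[of _ n]) simp
  then show "m \<in> prefix_positions h \<Longrightarrow> below h m n \<Longrightarrow> m < parent h n"
    by (simp add: below_def)
qed

lemma parent_le: "(\<And>m. m \<in> prefix_positions h \<Longrightarrow> below h m n \<Longrightarrow> m < p) \<Longrightarrow> parent h n \<le> p"
  unfolding parent_def by (rule Least_le) blast

lemma parent_eq_Suc: "parent h n = Suc m \<Longrightarrow> m \<in> prefix_positions h \<and> below h m n"
  by (metis less_SucE less_parent not_less_eq_eq order_refl parent_le)

text \<open>All quantifiers on the right are bounded, so the equation is decidable.\<close>

lemma parent_eq_iff:
  "parent h n = p \<longleftrightarrow>
    (\<forall>m<n. m \<in> prefix_positions h \<longrightarrow> below h m n \<longrightarrow> m < p) \<and>
    (\<forall>q<p. \<not> (\<forall>m<n. m \<in> prefix_positions h \<longrightarrow> below h m n \<longrightarrow> m < q))"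
  (is "_ \<longleftrightarrow> ?B p \<and> _")
proof
  assume p: "parent h n = p"
  have "\<not> ?B q" if "q < p" for q
    using parent_le[of h n q] that p by (auto simp: below_def)
  with p show "?B p \<and> (\<forall>q<p. \<not> ?B q)" by (auto dest: less_parent)
next
  assume "?B p \<and> (\<forall>q<p. \<not> ?B q)"
  then show "parent h n = p"
    unfolding parent_def by (intro Least_equality) (auto simp: not_le[symmetric])
qed

definition twist :: "(nat \<Rightarrow> nat) \<Rightarrow> nat set" where
  "twist f = {n \<in> prefix_positions (f \<circ> Suc). parent (f \<circ> Suc) n = f 0}"

definition twisted_history :: "(nat \<Rightarrow> nat) \<Rightarrow> nat \<Rightarrow> nat" where
  "twisted_history f n = (if n \<in> twist f then f (Suc n) else history f n)"

text \<open>If \<open>m\<close> were below \<open>n\<close>, then \<open>m\<close> would be smaller than the common parent number of \<open>m\<close> and \<open>n\<close>,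
  whereas the parent number of \<open>m\<close> never exceeds \<open>m\<close>.\<close>

lemma twist_antichain: "m \<in> twist f \<Longrightarrow> n \<in> twist f \<Longrightarrow> \<not> below (f \<circ> Suc) m n"
proof
  assume m: "m \<in> twist f" and n: "n \<in> twist f" and b: "below (f \<circ> Suc) m n"
  have "m < f 0" using less_parent[OF _ b] m n by (simp add: twist_def)
  also have "f 0 \<le> m"
    using parent_le[of "f \<circ> Suc" m m] m by (auto simp: twist_def below_def)
  finally show False by simp
qed

text \<open>Functions with different tails use almost disjoint sets of positions; functions with the same
  tail and different first values use the children of different nodes of the same forest.\<close>

lemma finite_twist_Int:
  assumes "f \<noteq> g"
  shows "finite (twist f \<inter> twist g)"
proof (cases "f \<circ> Suc = g \<circ> Suc")
  case True
  with assms have "f 0 \<noteq> g 0" by (metis comp_apply ext not0_implies_Suc)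
  with True have "twist f \<inter> twist g = {}" by (auto simp: twist_def)
  then show ?thesis by simp
next
  case False
  have "twist f \<inter> twist g \<subseteq> prefix_positions (f \<circ> Suc) \<inter> prefix_positions (g \<circ> Suc)" by (auto simp: twist_def)
  then show ?thesis using finite_prefix_positions_Int[OF False] by (rule finite_subset)
qed

text \<open>Two points of agreement with a history would be comparable in the forest.\<close>

lemma finite_twist_history: "finite {n \<in> twist f. f (Suc n) = history g n}" (is "finite ?A")
proof (cases "?A = {}")
  case False
  then obtain n where n: "n \<in> ?A" by blast
  have "m = n" if "m \<in> ?A" for m
    using that n twist_antichain[of m f n] twist_antichain[of n f m]
      below_if_history[of "f \<circ> Suc" m g n] below_if_history[of "f \<circ> Suc" n g m]
    by (auto intro: linorder_cases[of m n])
  then have "?A \<subseteq> {n}" by blast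
  then show ?thesis by (rule finite_subset) simp
next
  case True
  then show ?thesis by (simp only: finite.emptyI)
qed

lemma finite_history_eq:
  assumes "f \<noteq> g"
  shows "finite {n. history f n = history g n}"
proof -
  obtain d where d: "f d \<noteq> g d" using assms by blast
  have "n \<le> d" if "history f n = history g n" for n
    using that d by (metis entry_history not_le)
  then have "{n. history f n = history g n} \<subseteq> {..d}" by auto
  then show ?thesis by (rule finite_subset) simp
qed

lemma twisted_history_eventually_different:
  assumes "f \<noteq> g"
  shows "eventually_different (twisted_history f) (twisted_history g)"
proof -
  have "{n. twisted_history f n = twisted_history g n} \<subseteq> (twist f \<inter> twist g) \<union>
      {n \<in> twist f. f (Suc n) = history g n} \<union> {n \<in> twist g. g (Suc n) = history f n} \<union>
      {n. history f n = history g n}"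
    by (auto simp: twisted_history_def split: if_splits)
  then show ?thesis
    unfolding eventually_different_def
    by (rule finite_subset)
      (simp add: finite_twist_Int finite_twist_history finite_history_eq assms)
qed

section \<open>Maximality\<close>

text \<open>A descendant \<open>n\<close> of the node \<open>p - 1\<close> that is not its child lies above a child of it, namely the
  least node on the way to \<open>n\<close>. For \<open>p = 0\<close> the children are the roots.\<close>

lemma child_on_path:
  assumes "n \<in> prefix_positions h" "p < parent h n" "\<And>q. p = Suc q \<Longrightarrow> q \<in> prefix_positions h \<and> below h q n"
  shows "\<exists>m \<in> prefix_positions h. parent h m = p \<and> below h m n"
proof -
  let ?Q = "\<lambda>m. m \<in> prefix_positions h \<and> below h m n \<and> p \<le> m"
  have "?Q (parent h n - 1)"
    using assms(2) parent_eq_Suc[of h n "parent h n - 1"] by auto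
  define m where "m = (LEAST m. ?Q m)"
  have m: "?Q m" unfolding m_def using \<open>?Q (parent h n - 1)\<close> by (rule LeastI)
  have "parent h m \<le> p"
  proof (rule parent_le)
    fix l assume l: "l \<in> prefix_positions h" "below h l m"
    show "l < p"
    proof (rule ccontr)
      assume "\<not> l < p"
      then have "?Q l" using l m below_trans by (auto simp: not_less)
      then have "m \<le> l" unfolding m_def by (rule Least_le)
      then show False using l by (simp add: below_def)
    qed
  qed
  moreover have "p \<le> parent h m"
  proof (cases p)
    case (Suc q)
    have "below h q m" using below_linear[of h q n m] assms(3)[OF Suc] m Suc by auto
    then show ?thesis using less_parent[of q h m] assms(3)[OF Suc] Suc by simp
  qed simp
  ultimately show ?thesis using m by auto
qed

text \<open>Koenig's lemma for the forest. Starting from the roots, a node with infinitely many descendants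
  is chosen among the finitely many children of the node before. The values of \<open>h\<close> along the path
  are initial segments of one function \<open>g\<close>.\<close>

lemma infinite_path:
  assumes finite_fibres: "\<And>p. finite {n \<in> prefix_positions h. parent h n = p}"
  shows "\<exists>g. infinite {n \<in> prefix_positions h. h n = history g n}"
proof -
  (* the descendants of the node p - 1, or the whole forest if p = 0 *)
  define T where "T p = {n \<in> prefix_positions h. \<forall>q. p = Suc q \<longrightarrow> q \<in> prefix_positions h \<and> below h q n}" for p
  have step: "\<exists>m \<in> prefix_positions h. parent h m = p \<and> infinite (T (Suc m))" if "infinite (T p)" for p
  proof (rule ccontr)
    let ?K = "{n \<in> prefix_positions h. parent h n = p}"
    assume "\<not> ?thesis"
    then have "finite (?K \<union> (\<Union>m\<in>?K. T (Suc m)))" using finite_fibres[of p] by auto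
    moreover have "T p \<subseteq> ?K \<union> (\<Union>m\<in>?K. T (Suc m))"
    proof
      fix n assume n: "n \<in> T p"
      have "p \<le> parent h n"
        using n less_parent[of _ h n] by (cases p) (auto simp: T_def Suc_le_eq)
      then consider "parent h n = p" | "p < parent h n" by linarith
      then show "n \<in> ?K \<union> (\<Union>m\<in>?K. T (Suc m))"
      proof cases
        case 2
        then obtain m where "m \<in> prefix_positions h" "parent h m = p" "below h m n"
          using child_on_path[of n h p] n by (auto simp: T_def)
        then show ?thesis using n by (auto simp: T_def)
      qed (use n in \<open>simp add: T_def\<close>)
    qed
    ultimately show False using that finite_subset by blast
  qed
  have "\<exists>s. \<forall>i. (s i \<in> prefix_positions h \<and> infinite (T (Suc (s i)))) \<and> below h (s i) (s (Suc i))"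
  proof (rule dependent_nat_choice)
    have "infinite (T 0)" using infinite_prefix_positions[of h] by (simp add: T_def)
    from step[OF this] show "\<exists>m. m \<in> prefix_positions h \<and> infinite (T (Suc m))" by blast
  next
    fix m and i :: nat assume "m \<in> prefix_positions h \<and> infinite (T (Suc m))"
    then show "\<exists>m'. (m' \<in> prefix_positions h \<and> infinite (T (Suc m'))) \<and> below h m m'"
      using step parent_eq_Suc by blast
  qed
  then obtain s where s: "\<And>i. s i \<in> prefix_positions h" "\<And>i. below h (s i) (s (Suc i))" by blast
  have below: "below h (s i) (s j)" if "i < j" for i j
    using that by (induction j) (auto simp: less_Suc_eq intro: s below_trans)
  have mono: "strict_mono s" using below by (auto simp: strict_mono_def below_def)
  define g where "g i = entry (h (s (Suc i))) i" for i
  have "h (s i) = history g (s i)" for i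
    unfolding history_eq_iff
  proof (intro conjI allI impI)
    show "len (h (s i)) = s i" using s(2)[of i] by (simp add: below_def)
    fix j assume j: "j < s i"
    have j': "j < s (Suc j)" using strict_mono_imp_increasing[OF mono, of "Suc j"] by simp
    show "entry (h (s i)) j = g j"
      using j j' below[of i "Suc j"] below[of "Suc j" i]
      by (cases i "Suc j" rule: linorder_cases) (auto simp: g_def below_def)
  qed
  then have "range s \<subseteq> {n \<in> prefix_positions h. h n = history g n}" using s(1) by auto
  moreover have "infinite (range s)"
    using mono finite_imageD infinite_UNIV_nat strict_mono_imp_inj_on by blast
  ultimately show ?thesis using finite_subset by blast
qed

text \<open>In the case of a path \<open>g\<close>, twisting could destroy the agreement of \<open>history g\<close> with \<open>h\<close>. But if it
  changes infinitely many of the relevant values, the position sets of \<open>h\<close> and \<open>g \<circ> Suc\<close> have an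
  infinite intersection, so \<open>h = g \<circ> Suc\<close>, and then the new values are again those of \<open>h\<close>.\<close>

lemma twisted_history_meets_every_function: "\<exists>f. infinite {n. twisted_history f n = h n}"
proof (cases "\<exists>p. infinite {n \<in> prefix_positions h. parent h n = p}")
  case True
  then obtain p where p: "infinite {n \<in> prefix_positions h. parent h n = p}" by blast
  define f where "f = case_nat p h"
  have "f \<circ> Suc = h" by (auto simp: f_def)
  then have "{n \<in> prefix_positions h. parent h n = p} \<subseteq> {n. twisted_history f n = h n}"
    by (auto simp: twisted_history_def twist_def f_def)
  with p show ?thesis using finite_subset by blast
next
  case False
  then obtain g where g: "infinite {n \<in> prefix_positions h. h n = history g n}" (is "infinite ?X")
    using infinite_path[of h] by blast
  have "infinite {n. twisted_history g n = h n}"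
  proof (cases "finite (?X \<inter> twist g)")
    case True
    with g have "infinite (?X - twist g)" by (metis Diff_Diff_Int Diff_infinite_finite Int_Diff_Un finite_Un)
    moreover have "?X - twist g \<subseteq> {n. twisted_history g n = h n}" by (auto simp: twisted_history_def)
    ultimately show ?thesis using finite_subset by blast
  next
    case False
    have "?X \<inter> twist g \<subseteq> prefix_positions h \<inter> prefix_positions (g \<circ> Suc)" by (auto simp: twist_def)
    with False have "h = g \<circ> Suc" using finite_prefix_positions_Int finite_subset by blast
    then have "?X \<inter> twist g \<subseteq> {n. twisted_history g n = h n}" by (auto simp: twisted_history_def)
    with False show ?thesis using finite_subset by blast
  qed
  then show ?thesis by blast
qed

lemma maximal_range_twisted_history: "maximal_ev_diff_family (range twisted_history)"
  unfolding maximal_ev_diff_family_def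
proof (intro conjI allI impI)
  show "ev_diff_family (range twisted_history)"
    unfolding ev_diff_family_def pairwise_def by (auto intro!: twisted_history_eventually_different)
next
  fix F assume F: "ev_diff_family F" "range twisted_history \<subseteq> F"
  have "h \<in> range twisted_history" if h: "h \<in> F" for h
  proof -
    obtain f where "infinite {n. twisted_history f n = h n}" using twisted_history_meets_every_function by blast
    then have "\<not> eventually_different (twisted_history f) h" by (simp add: eventually_different_def)
    then have "twisted_history f = h"
      using F h by (auto simp: ev_diff_family_def pairwise_def)
    then show ?thesis by blast
  qed
  with F show "F = range twisted_history" by blast
qed

section \<open>Effective closedness\<close>

lemma len_le: "len x \<le> x"
proof -
  have "length xs \<le> list_encode xs" for xs
  proof (induction xs)
    case (Cons x xs)
    then show ?case using le_prod_encode_2[of "list_encode xs" x] by simp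
  qed simp
  from this[of "list_decode x"] show ?thesis by simp
qed

lemma prefix_positions_cong:
  assumes "\<And>i. i < n \<Longrightarrow> h i = h' i"
  shows "n \<in> prefix_positions h \<longleftrightarrow> n \<in> prefix_positions h'"
proof -
  have "(\<forall>i<len x. entry x i = h i) \<longleftrightarrow> (\<forall>i<len x. entry x i = h' i)" if "x < n" for x
    using that assms len_le[of x] by auto
  then show ?thesis unfolding prefix_positions_def by blast
qed

lemma parent_cong:
  assumes "\<And>i. i \<le> n \<Longrightarrow> h i = h' i"
  shows "parent h n = parent h' n"
proof -
  have "m \<in> prefix_positions h \<longleftrightarrow> m \<in> prefix_positions h'" if "m < n" for m
    using that assms by (intro prefix_positions_cong) simp
  moreover have "below h m n \<longleftrightarrow> below h' m n" if "m < n" for m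
    using that assms by (simp add: below_def)
  ultimately show ?thesis unfolding parent_def by simp
qed

text \<open>A number that encodes a sequence is at least as large as its length, so all the initial segments
  that matter for the position \<open>n\<close> have length at most \<open>n\<close>.\<close>

lemma twisted_history_cong:
  assumes "\<And>i. i \<le> Suc n \<Longrightarrow> f i = f' i"
  shows "twisted_history f n = twisted_history f' n"
proof -
  have "n \<in> prefix_positions (f \<circ> Suc) \<longleftrightarrow> n \<in> prefix_positions (f' \<circ> Suc)"
    using assms by (intro prefix_positions_cong) simp
  moreover have "parent (f \<circ> Suc) n = parent (f' \<circ> Suc) n"
    using assms by (intro parent_cong) simp
  moreover have "history f n = history f' n" using assms by (simp add: history_def list_encode_eq)
  ultimately show ?thesis using assms by (simp add: twisted_history_def twist_def)
qed

lemma twisted_history_even: "even n \<Longrightarrow> twisted_history f n = history f n"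
  using odd_prefix_positions by (auto simp: twisted_history_def twist_def)

text \<open>The function \<open>f\<close> is recovered from the even values, which have to be coherent initial segments:
  the condition at an even \<open>n\<close> says that \<open>\<phi> n\<close> is the restriction to \<open>n\<close> of every later one. The
  bound \<open>Suc n < j\<close> holds because the value at \<open>n\<close> depends on \<open>f\<close> up to \<open>Suc n\<close>.\<close>

lemma range_twisted_history_iff:
  "\<phi> \<in> range twisted_history \<longleftrightarrow>
    (\<forall>j n. even j \<longrightarrow> Suc n < j \<longrightarrow> \<phi> n = twisted_history (entry (\<phi> j)) n)"
proof
  assume "\<phi> \<in> range twisted_history"
  then obtain f where f: "\<phi> = twisted_history f" by blast
  have "\<phi> n = twisted_history (entry (\<phi> j)) n" if "even j" "Suc n < j" for j n
    unfolding f twisted_history_even[OF \<open>even j\<close>]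
    by (rule twisted_history_cong) (use that in simp)
  then show "\<forall>j n. even j \<longrightarrow> Suc n < j \<longrightarrow> \<phi> n = twisted_history (entry (\<phi> j)) n"
    by blast
next
  assume \<phi>: "\<forall>j n. even j \<longrightarrow> Suc n < j \<longrightarrow> \<phi> n = twisted_history (entry (\<phi> j)) n"
  have coherent: "entry (\<phi> m) i = entry (\<phi> j) i" if "even m" "even j" "i < m" "m < j" for m j i
  proof -
    have "Suc m < j" using that by presburger
    then have "\<phi> m = twisted_history (entry (\<phi> j)) m" using \<phi> \<open>even j\<close> by blast
    then have "\<phi> m = history (entry (\<phi> j)) m" using \<open>even m\<close> by (simp only: twisted_history_even)
    with \<open>i < m\<close> show ?thesis by (simp only: entry_history)
  qed
  define f where "f i = entry (\<phi> (2 * Suc i)) i" for i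
  have f: "f i = entry (\<phi> j) i" if "even j" "i < j" for i j
  proof (cases "2 * Suc i" j rule: linorder_cases)
    case less
    have "entry (\<phi> (2 * Suc i)) i = entry (\<phi> j) i" by (rule coherent) (use that less in auto)
    then show ?thesis by (simp only: f_def)
  next
    case equal
    then show ?thesis by (simp only: f_def)
  next
    case greater
    have "entry (\<phi> j) i = entry (\<phi> (2 * Suc i)) i" by (rule coherent) (use that greater in auto)
    then show ?thesis by (simp only: f_def)
  qed
  have "twisted_history f n = \<phi> n" for n
  proof -
    have "twisted_history f n = twisted_history (entry (\<phi> (2 * Suc n))) n" by (intro twisted_history_cong f) auto
    also have "\<dots> = \<phi> n" using \<phi>[rule_format, of "2 * Suc n" n] by simp
    finally show ?thesis .
  qed
  then have "twisted_history f = \<phi>" by (rule ext)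
  then show "\<phi> \<in> range twisted_history" by blast
qed

lemma decidable_twisted_history: "decidable (\<lambda>e. e 0 = twisted_history (entry (e 1)) (e 2))"
proof -
  have eq: "v = twisted_history (entry y) n \<longleftrightarrow>
      n \<in> twist (entry y) \<and> v = entry y (Suc n) \<or>
      \<not> n \<in> twist (entry y) \<and> len v = n \<and> (\<forall>i<n. entry v i = entry y i)" for v y n
    by (auto simp: twisted_history_def history_eq_iff)
  show ?thesis
    unfolding eq twist_def prefix_positions_def below_def parent_eq_iff mem_Collect_eq o_apply
    by (intro computability_intros computable_entries)
qed

lemma effectively_closed_range_twisted_history: "effectively_closed (range twisted_history)"
proof -
  define S where "S = {s. \<exists>j<length s. even j \<and>
      (\<exists>n<j. Suc n < j \<and> s ! n \<noteq> twisted_history (entry (s ! j)) n)}"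
  (* evenness and inequality are spelled out in the connectives whose decidability is known *)
  define bad where "bad x \<longleftrightarrow> (\<exists>j<len x. (\<exists>i<Suc j. j = i + i) \<and>
      (\<exists>n<j. Suc n < j \<and> \<not> entry x n = twisted_history (entry (entry x j)) n))" for x
  have even: "even j \<longleftrightarrow> (\<exists>i<Suc j. j = i + i)" for j :: nat
    by presburger
  have S_iff: "s \<in> S \<longleftrightarrow> bad (list_encode s)" for s
    unfolding S_def bad_def even[symmetric] mem_Collect_eq
    by (intro ex_cong1 conj_cong refl) (auto simp: entry_list_encode)
  have "list_encode ` S = {x. bad x}"
  proof (intro equalityI subsetI)
    fix x assume "x \<in> {x. bad x}"
    then have "list_decode x \<in> S" by (simp add: S_iff)
    then show "x \<in> list_encode ` S" by (metis imageI list_decode_inverse)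
  qed (auto simp: S_iff)
  moreover have "comp_enumerable {x. bad x}"
  proof (rule comp_enumerable_decidable)
    have dec: "decidable (\<lambda>e. V e = twisted_history (entry (Y e)) (N e))"
      if "computable V" "computable Y" "computable N" for V Y N
    proof -
      let ?H = "\<lambda>j :: nat. if j = 0 then V else if j = 1 then Y else N"
      have "computable (?H j)" for j using that by simp
      from computable_substitute[OF decidable_twisted_history[unfolded decidable_def], of ?H, OF this]
      show ?thesis by (simp add: decidable_def)
    qed
    show "decidable (\<lambda>e. bad (e 0))"
      unfolding bad_def by (intro dec computability_intros computable_entries)
  qed
  moreover have "- range twisted_history = (\<Union>s\<in>S. basic_open s)"
  proof (intro equalityI subsetI)
    fix \<phi> assume "\<phi> \<in> - range twisted_history"
    then obtain j n where jn: "even j" "Suc n < j" "\<phi> n \<noteq> twisted_history (entry (\<phi> j)) n"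
      unfolding Compl_iff range_twisted_history_iff by blast
    let ?s = "map \<phi> [0..<Suc j]"
    have "?s ! i = \<phi> i" if "i \<le> j" for i using that by (simp add: less_Suc_eq_le del: upt_Suc)
    with jn have "?s ! n \<noteq> twisted_history (entry (?s ! j)) n" by (simp del: upt_Suc)
    moreover have "j < length ?s" "n < j" using jn by simp_all
    ultimately have "?s \<in> S" unfolding S_def using jn by blast
    moreover have "\<phi> \<in> basic_open ?s" by (simp add: basic_open_def del: upt_Suc)
    ultimately show "\<phi> \<in> (\<Union>s\<in>S. basic_open s)" by blast
  next
    fix \<phi> assume "\<phi> \<in> (\<Union>s\<in>S. basic_open s)"
    then obtain s j n where s: "\<forall>i<length s. \<phi> i = s ! i" and
      jn: "j < length s" "even j" "Suc n < j" "s ! n \<noteq> twisted_history (entry (s ! j)) n"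
      by (auto simp: S_def basic_open_def)
    then have "\<phi> n \<noteq> twisted_history (entry (\<phi> j)) n" by simp
    with jn show "\<phi> \<in> - range twisted_history" unfolding Compl_iff range_twisted_history_iff by blast
  qed
  ultimately show ?thesis unfolding effectively_closed_def by metis
qed

theorem theorem1p2:
  "\<exists>E :: (nat \<Rightarrow> nat) set. effectively_closed E \<and> maximal_ev_diff_family E"
  using effectively_closed_range_twisted_history maximal_range_twisted_history by blast

end
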